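(* Let $\mathcal{H}$ and $\mathcal{G}_i$, $i=1,\ldots,m$, be real Hilbert spaces, $A:\mathcal{H}\to2^{\mathcal{H}}$ maximally monotone, and $C:\mathcal{H}\to\mathcal{H}$ monotone and $\mu$-Lipschitzian for some $\mu>0$. Let $z\in\mathcal{H}$ and, for every $i\in\{1,\ldots,m\}$, let $r_i\in\mathcal{G}_i$, let $B_i:\mathcal{G}_i\to2^{\mathcal{G}_i}$ be maximally monotone, let $D_i:\mathcal{G}_i\to2^{\mathcal{G}_i}$ be monotone such that $D_i^{-1}$ is $\nu_i$-Lipschitzian for some $\nu_i>0$, and let $L_i:\mathcal{H}\to\mathcal{G}_i$ be a nonzero linear continuous operator. Suppose that $A+C$ is $\rho$-strongly monotone with $\rho>0$ and that $B_i^{-1}+D_i^{-1}$ is $\tau_i$-strongly monotone with $\tau_i>0$ for $i=1,\ldots,m$. Let $(\overline{x},\overline{v}_1,\ldots,\overline{v}_m)\in\mathcal{H}\times\mathcal{G}_1\times\cdots\times\mathcal{G}_m$ be a primal-dual solution, i.e. $$z-\sum_{i=1}^mL_i^*\overline{v}_i\in A\overline{x}+C\overline{x}\quad\text{and}\quad\overline{v}_i\in(B_i\,\square\,D_i)(L_i\overline{x}-r_i),\ i=1,\ldots,m.$$ Set $\rho_{\min}=\min\{\rho,\tau_1,\ldots,\tau_m\}$, let $x_0\in\mathcal{H}$, $(v_{1,0},\ldots,v_{m,0})\in\mathcal{G}_1\times\cdots\times\mathcal{G}_m$, and let $\gamma\in(0,1)$ be such that $$\gamma\le\frac{1}{\sqrt{1+2\rho_{\min}}\Big(\sqrt{\sum_{i=1}^m\|L_i\|^2}+\max\{\mu,\nu_1,\ldots,\nu_m\}\Big)}.$$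 Define for all $n\ge0$ (and all $i=1,\ldots,m$) $$\begin{aligned} p_{1,n}&=J_{\gamma A}\Big(x_n-\gamma\Big(Cx_n+\sum_{i=1}^mL_i^*v_{i,n}-z\Big)\Big),\\ p_{2,i,n}&=J_{\gamma B_i^{-1}}\big(v_{i,n}+\gamma(L_ix_n-D_i^{-1}v_{i,n}-r_i)\big),\\ v_{i,n+1}&=\gamma L_i(p_{1,n}-x_n)+\gamma(D_i^{-1}v_{i,n}-D_i^{-1}p_{2,i,n})+p_{2,i,n},\\ x_{n+1}&=\gamma\sum_{i=1}^mL_i^*(v_{i,n}-p_{2,i,n})+\gamma(Cx_n-Cp_{1,n})+p_{1,n}. \end{aligned}$$ Then for every $n\ge0$ $$\|x_n-\overline{x}\|^2+\sum_{i=1}^m\|v_{i,n}-\overline{v}_i\|^2\le\Big(\frac{1}{1+2\rho_{\min}\gamma(1-\gamma)}\Big)^n\Big(\|x_0-\overline{x}\|^2+\sum_{i=1}^m\|v_{i,0}-\overline{v}_i\|^2\Big).$$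
   Context: A set-valued operator $M:\mathcal{H}\to2^{\mathcal{H}}$ is monotone if $\langle x-y,u-v\rangle\ge0$ for all $u\in Mx$, $v\in My$; maximally monotone if its graph is not properly contained in the graph of another monotone operator; $\rho$-strongly monotone ($\rho>0$) if $\langle x-y,u-v\rangle\ge\rho\|x-y\|^2$ for all $u\in Mx$, $v\in My$. An operator is $\nu$-Lipschitzian if it is single-valued (and everywhere defined) with $\|Mx-My\|\le\nu\|x-y\|$. $M^{-1}(u)=\{x:u\in Mx\}$; $J_M=(\mathrm{Id}+M)^{-1}$ is the resolvent, single-valued and everywhere defined for maximally monotone $M$. The parallel sum is $M_1\,\square\,M_2=(M_1^{-1}+M_2^{-1})^{-1}$. $L_i^*$ is the adjoint of $L_i$. *)

theory Defs
  imports "HOL-Analysis.Analysis"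
begin

(*
  A Hilbert space that is not a type of its own is represented by a complete linear subspace S of
  a type of class real_inner, with the inherited inner product. A family of Hilbert spaces
  indexed by 1, ..., m thus becomes a family of complete subspaces of one ambient inner product
  space; up to isometric isomorphism this is no restriction, since the ambient space may be
  (a space containing) the orthogonal direct sum of the family.
*)
definition hilbert_subspace :: "'a::real_inner set \<Rightarrow> bool" where
  "hilbert_subspace S \<longleftrightarrow> subspace S \<and> complete S"

(*
  A set-valued operator S -> 2^S is a function on the ambient type whose graph lies in S x S. Since
  its values off S are empty, inverses, sums and resolvents of operators on S are again
  operators on S and need no reference to S.
*)
definition operator_on :: "'a set \<Rightarrow> ('a \<Rightarrow> 'a set) \<Rightarrow> bool" where
  "operator_on S M \<longleftrightarrow> (\<forall>x u. u \<in> M x \<longrightarrow> x \<in> S \<and> u \<in> S)"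

definition op_graph :: "('a \<Rightarrow> 'a set) \<Rightarrow> ('a \<times> 'a) set" where
  "op_graph M = {(x, u). u \<in> M x}"

definition monotone_op :: "('a::real_inner \<Rightarrow> 'a set) \<Rightarrow> bool" where
  "monotone_op M \<longleftrightarrow> (\<forall>x y u v. u \<in> M x \<longrightarrow> v \<in> M y \<longrightarrow> (x - y) \<bullet> (u - v) \<ge> 0)"

definition maximally_monotone_on :: "'a::real_inner set \<Rightarrow> ('a \<Rightarrow> 'a set) \<Rightarrow> bool" where
  "maximally_monotone_on S M \<longleftrightarrow>
     operator_on S M \<and> monotone_op M \<and>
     \<not> (\<exists>N. operator_on S N \<and> monotone_op N \<and> op_graph M \<subset> op_graph N)"

definition strongly_monotone_op :: "real \<Rightarrow> ('a::real_inner \<Rightarrow> 'a set) \<Rightarrow> bool" where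
  "strongly_monotone_op \<rho> M \<longleftrightarrow>
     (\<forall>x y u v. u \<in> M x \<longrightarrow> v \<in> M y \<longrightarrow> (x - y) \<bullet> (u - v) \<ge> \<rho> * (norm (x - y))\<^sup>2)"

(* The set-valued operator identified with an everywhere defined single-valued one. *)
definition single_op :: "('a \<Rightarrow> 'a) \<Rightarrow> ('a \<Rightarrow> 'a set)" where
  "single_op f x = {f x}"

(*
  The value of a single-valued operator; meaningful only at points x where M x is a singleton.
*)
definition op_val :: "('a \<Rightarrow> 'a set) \<Rightarrow> 'a \<Rightarrow> 'a" where
  "op_val M x = the_elem (M x)"

definition lipschitzian_op_on :: "real \<Rightarrow> 'a::metric_space set \<Rightarrow> ('a \<Rightarrow> 'a set) \<Rightarrow> bool" where
  "lipschitzian_op_on \<nu> S M \<longleftrightarrow> (\<forall>x\<in>S. is_singleton (M x)) \<and> \<nu>-lipschitz_on S (op_val M)"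

definition op_inv :: "('a \<Rightarrow> 'a set) \<Rightarrow> ('a \<Rightarrow> 'a set)" where
  "op_inv M u = {x. u \<in> M x}"

definition op_add :: "('a::plus \<Rightarrow> 'a set) \<Rightarrow> ('a \<Rightarrow> 'a set) \<Rightarrow> ('a \<Rightarrow> 'a set)" where
  "op_add M N x = {u + v | u v. u \<in> M x \<and> v \<in> N x}"

definition op_scale :: "real \<Rightarrow> ('a::real_vector \<Rightarrow> 'a set) \<Rightarrow> ('a \<Rightarrow> 'a set)" where
  "op_scale \<gamma> M x = {\<gamma> *\<^sub>R u | u. u \<in> M x}"

definition parallel_sum :: "('a::plus \<Rightarrow> 'a set) \<Rightarrow> ('a \<Rightarrow> 'a set) \<Rightarrow> ('a \<Rightarrow> 'a set)" where
  "parallel_sum M N = op_inv (op_add (op_inv M) (op_inv N))"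

(* If M is an operator on S then Id + M is automatically restricted to S, as M x = {} off S. *)
definition resolvent :: "('a::plus \<Rightarrow> 'a set) \<Rightarrow> ('a \<Rightarrow> 'a set)" where
  "resolvent M = op_inv (op_add (single_op id) M)"

end

theory Submission
  imports Defs
begin

text \<open>
  Why the iteration contracts. On the Hilbert sum of the primal space and the dual spaces let
  \<open>\<M> (x, v) = (A x - z, B\<^sub>i\<inverse> v\<^sub>i + r\<^sub>i)\<close> and
  \<open>Q (x, v) = (C x + \<Sum>\<^sub>i L\<^sub>i\<^sup>* v\<^sub>i, D\<^sub>i\<inverse> v\<^sub>i - L\<^sub>i x)\<close>. A primal-dual solution is a zero of \<open>\<M> + Q\<close>, and with
  \<open>w\<^sub>n = (x\<^sub>n, v\<^sub>n)\<close> the iteration is Tseng's forward-backward-forward method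
  \<open>p\<^sub>n = J (w\<^sub>n - \<gamma> Q w\<^sub>n)\<close>, \<open>w\<^sub>n\<^sub>+\<^sub>1 = p\<^sub>n + \<gamma> (Q w\<^sub>n - Q p\<^sub>n)\<close>, where \<open>J\<close> is the resolvent of \<open>\<gamma> \<M>\<close>.
  By construction \<open>(w\<^sub>n - w\<^sub>n\<^sub>+\<^sub>1) / \<gamma>\<close> is an element of \<open>(\<M> + Q) p\<^sub>n\<close>. The coupling terms in \<open>L\<^sub>i\<close> are
  skew, so they cancel in inner products and \<open>\<M> + Q\<close> is strongly monotone with constant
  \<open>\<rho>min\<close>; comparing \<open>p\<^sub>n\<close> with the solution \<open>w\<close> gives
  \<open>\<langle>p\<^sub>n - w, w\<^sub>n - w\<^sub>n\<^sub>+\<^sub>1\<rangle> \<ge> \<gamma> \<rho>min \<parallel>p\<^sub>n - w\<parallel>\<^sup>2\<close>. Expanding squares turns this into a decrease of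
  \<open>\<parallel>w\<^sub>n - w\<parallel>\<^sup>2\<close>, up to the error \<open>\<parallel>w\<^sub>n\<^sub>+\<^sub>1 - p\<^sub>n\<parallel>\<^sup>2 - \<parallel>w\<^sub>n - p\<^sub>n\<parallel>\<^sup>2\<close>; since \<open>Q\<close> is Lipschitzian with constant
  \<open>sqrt (\<Sum>\<^sub>i \<parallel>L\<^sub>i\<parallel>\<^sup>2) + max {\<mu>, \<nu>\<^sub>i}\<close>, the bound on \<open>\<gamma>\<close> makes this error nonpositive, with just
  enough room to replace \<open>\<parallel>p\<^sub>n - w\<parallel>\<close> by \<open>\<parallel>w\<^sub>n\<^sub>+\<^sub>1 - w\<parallel>\<close>. The lemmas \<open>tseng_step_component\<close>,
  \<open>skew_block_sum_le\<close> and \<open>primal_dual_step\<close> carry this argument. It is carried out on components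
  and summed, because the Hilbert sum of a varying number of subspaces is not itself a type.

  The iteration makes sense only if adjoints and resolvents exist: \<open>adjoint\<close> is a choice operator
  and \<open>op_val\<close> is meaningful only at singletons. Both existence questions, the Riesz
  representation and Minty's surjectivity theorem, reduce to one fact, \<open>quadratic_minimizer\<close>: on a
  complete convex set of pairs \<open>(x, t)\<close> the function \<open>t + \<parallel>x\<parallel>\<^sup>2 / 2\<close> attains its infimum once it is bounded
  below. For Riesz the set is the graph of minus the functional. For Minty it is the epigraph of
  the Fitzpatrick function of the operator, and the variational inequality at the minimiser,
  tested against the graph of the operator, produces the required point.
\<close>

section \<open>Minimising a quadratic perturbation over a complete convex set\<close>

text \<open>
  The objective is \<open>t + \<parallel>x\<parallel>\<^sup>2 / 2\<close>, and no weak compactness enters: by the parallelogram law the first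
  components of a minimising sequence are Cauchy, and then so are the second components, since the values of the
  objective converge. The inequality in the conclusion is the first-order optimality condition.
\<close>

lemma quadratic_minimizer:
  fixes K :: "('a::real_inner \<times> real) set"
  assumes K: "convex K" "complete K" "K \<noteq> {}"
    and lower: "\<And>x t. (x, t) \<in> K \<Longrightarrow> c \<le> t + (norm x)\<^sup>2 / 2"
  obtains x0 t0 where "(x0, t0) \<in> K" "\<And>x t. (x, t) \<in> K \<Longrightarrow> t0 \<le> t + x0 \<bullet> (x - x0)"
proof -
  define q :: "'a \<times> real \<Rightarrow> real" where "q = (\<lambda>p. snd p + (norm (fst p))\<^sup>2 / 2)"
  define d where "d = Inf (q ` K)"
  have bdd: "bdd_below (q ` K)"
    using lower by (intro bdd_belowI[of _ c]) (auto simp: q_def)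
  have d_le: "d \<le> q p" if "p \<in> K" for p
    unfolding d_def using bdd that by (auto intro: cInf_lower)
  have "\<exists>p\<in>K. q p < d + 1 / Suc n" for n
    using cInf_lessD[of "q ` K" "d + 1 / Suc n"] K(3) by (auto simp: d_def)
  then obtain P where P: "\<And>n. P n \<in> K" "\<And>n. q (P n) < d + 1 / Suc n"
    by metis
  \<comment> \<open>Compare the values at two points with the value at their midpoint.\<close>
  have gap: "(norm (fst p - fst p'))\<^sup>2 \<le> 4 * (q p - d) + 4 * (q p' - d)"
    if "p \<in> K" "p' \<in> K" for p p'
  proof -
    have "(1/2) *\<^sub>R p + (1/2) *\<^sub>R p' \<in> K"
      using K(1) that by (auto simp: convex_def)
    from d_le[OF this] show ?thesis
      by (simp add: q_def power2_norm_eq_inner algebra_simps inner_commute add_divide_distrib)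
  qed
  have lim0: "(\<lambda>n. 1 / real (Suc n)) \<longlonglongrightarrow> 0"
    using LIMSEQ_inverse_real_of_nat by (simp add: inverse_eq_divide)
  have Cauchy_fst: "Cauchy (\<lambda>n. fst (P n))"
  proof (rule metric_CauchyI)
    fix e :: real assume "0 < e"
    then have "\<forall>\<^sub>F n in sequentially. 1 / real (Suc n) < e\<^sup>2 / 8"
      using order_tendstoD(2)[OF lim0, of "e\<^sup>2 / 8"] by simp
    then obtain N where N: "\<And>n. n \<ge> N \<Longrightarrow> 1 / real (Suc n) < e\<^sup>2 / 8"
      by (auto simp: eventually_sequentially)
    have "dist (fst (P m)) (fst (P n)) < e" if "m \<ge> N" "n \<ge> N" for m n
    proof -
      have "(dist (fst (P m)) (fst (P n)))\<^sup>2 < e\<^sup>2"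
        using gap[OF P(1)[of m] P(1)[of n]]
          order_less_trans[OF P(2)[of m] add_strict_left_mono[OF N[OF that(1)]]]
          order_less_trans[OF P(2)[of n] add_strict_left_mono[OF N[OF that(2)]]]
        by (simp add: dist_norm)
      then show ?thesis
        using \<open>0 < e\<close> by (auto intro: power_less_imp_less_base)
    qed
    then show "\<exists>M. \<forall>m\<ge>M. \<forall>n\<ge>M. dist (fst (P m)) (fst (P n)) < e" by blast
  qed
  have q_lim: "(\<lambda>n. q (P n)) \<longlonglongrightarrow> d"
  proof (rule tendsto_sandwich)
    show "\<forall>\<^sub>F n in sequentially. d \<le> q (P n)" using d_le P(1) by simp
    show "\<forall>\<^sub>F n in sequentially. q (P n) \<le> d + 1 / real (Suc n)"
      using P(2) by (intro always_eventually) (auto intro: less_imp_le)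
    show "(\<lambda>n. d + 1 / real (Suc n)) \<longlonglongrightarrow> d" using tendsto_add[OF tendsto_const lim0] by simp
  qed simp
  \<comment> \<open>The norms of the first components converge in the reals; together with the values of the
    objective this makes the second components Cauchy, and completeness of \<open>K\<close> provides the limit.\<close>
  have "Cauchy (\<lambda>n. norm (fst (P n)))"
  proof (rule metric_CauchyI)
    fix e :: real assume "0 < e"
    then obtain N where "\<And>m n. m \<ge> N \<Longrightarrow> n \<ge> N \<Longrightarrow> dist (fst (P m)) (fst (P n)) < e"
      using Cauchy_fst by (meson metric_CauchyD)
    then show "\<exists>M. \<forall>m\<ge>M. \<forall>n\<ge>M. dist (norm (fst (P m))) (norm (fst (P n))) < e"
      by (metis dist_norm norm_triangle_ineq3 order_le_less_trans real_norm_def)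
  qed
  then obtain l where l: "(\<lambda>n. norm (fst (P n))) \<longlonglongrightarrow> l"
    using Cauchy_convergent convergent_def by blast
  have "(\<lambda>n. q (P n) - (norm (fst (P n)))\<^sup>2 / 2) \<longlonglongrightarrow> d - l\<^sup>2 / 2"
    by (intro tendsto_intros q_lim l) auto
  then have Cauchy_snd: "Cauchy (\<lambda>n. snd (P n))"
    by (intro LIMSEQ_imp_Cauchy) (simp add: q_def)
  have "Cauchy P"
  proof (rule metric_CauchyI)
    fix e :: real assume "0 < e"
    then obtain M N where "\<And>m n. m \<ge> M \<Longrightarrow> n \<ge> M \<Longrightarrow> dist (fst (P m)) (fst (P n)) < e / 2"
      and "\<And>m n. m \<ge> N \<Longrightarrow> n \<ge> N \<Longrightarrow> dist (snd (P m)) (snd (P n)) < e / 2"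
      using metric_CauchyD[OF Cauchy_fst, of "e / 2"] metric_CauchyD[OF Cauchy_snd, of "e / 2"]
      by (metis half_gt_zero)
    moreover have "dist (P m) (P n) \<le> dist (fst (P m)) (fst (P n)) + dist (snd (P m)) (snd (P n))"
      for m n
      by (simp add: dist_prod_def sqrt_sum_squares_le_sum)
    ultimately have "dist (P m) (P n) < e" if "m \<ge> max M N" "n \<ge> max M N" for m n
      using that by (smt (verit, best) field_sum_of_halves max.bounded_iff)
    then show "\<exists>M. \<forall>m\<ge>M. \<forall>n\<ge>M. dist (P m) (P n) < e" by blast
  qed
  then obtain p0 where p0: "p0 \<in> K" "P \<longlonglongrightarrow> p0"
    using completeE[OF K(2)] P(1) by blast
  have "(\<lambda>n. q (P n)) \<longlonglongrightarrow> q p0"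
    unfolding q_def by (intro tendsto_intros p0(2)) auto
  then have q0: "q p0 = d"
    using q_lim LIMSEQ_unique by blast
  \<comment> \<open>Move from the minimiser a fraction \<open>s\<close> of the way to \<open>p\<close>, divide by \<open>s\<close> and let \<open>s\<close> tend to 0.\<close>
  have var: "snd p0 \<le> snd p + fst p0 \<bullet> (fst p - fst p0)" if p: "p \<in> K" for p
  proof -
    define a where "a = snd p - snd p0 + fst p0 \<bullet> (fst p - fst p0)"
    define b where "b = (norm (fst p - fst p0))\<^sup>2 / 2"
    have "0 \<le> a + s * b" if s: "0 < s" "s < 1" for s
    proof -
      have "(1 - s) *\<^sub>R p0 + s *\<^sub>R p \<in> K"
        using K(1) p p0(1) s by (auto simp: convex_def)
      from d_le[OF this] have "0 \<le> s * (a + s * b)"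
        unfolding q0[symmetric]
        by (simp add: q_def a_def b_def power2_norm_eq_inner algebra_simps inner_commute
            add_divide_distrib diff_divide_distrib)
      then show ?thesis using s by (simp add: zero_le_mult_iff)
    qed
    then have ev: "\<forall>\<^sub>F s in at_right 0. 0 \<le> a + s * b"
      by (auto simp: eventually_at_right_field intro!: exI[of _ 1])
    have "((\<lambda>s. a + s * b) \<longlongrightarrow> a + 0 * b) (at_right 0)"
      by (intro tendsto_intros)
    then have "0 \<le> a"
      using tendsto_lowerbound[OF _ ev] by simp
    then show ?thesis by (simp add: a_def)
  qed
  show ?thesis
    using that[of "fst p0" "snd p0"] p0(1) var by fastforce
qed

section \<open>Adjoints on Hilbert spaces\<close>

text \<open>
  The minimiser \<open>w\<close> of \<open>\<parallel>x\<parallel>\<^sup>2 / 2 - f x\<close> represents \<open>f\<close>: its optimality condition reads \<open>f y \<le> w \<bullet> y\<close> for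
  every direction \<open>y\<close>, and the direction \<open>- y\<close> gives the converse.
\<close>

lemma riesz_representation:
  fixes f :: "'a::{real_inner, complete_space} \<Rightarrow> real"
  assumes f: "bounded_linear f"
  obtains w where "\<And>x. f x = w \<bullet> x"
proof -
  interpret f: bounded_linear f by fact
  let ?K = "(\<lambda>x. (x, - f x)) ` UNIV"
  have conv: "convex ?K"
    by (intro convex_linear_image linearI) (auto simp: f.add f.scaleR)
  have "?K = {p. snd p = - f (fst p)}" by force
  moreover have "closed {p. snd p = - f (fst p)}"
    by (intro closed_Collect_eq continuous_intros f.continuous_on)
  ultimately have compl: "complete ?K"
    by (simp add: complete_eq_closed)
  obtain b where b: "\<And>x. norm (f x) \<le> norm x * b"
    using f.bounded by blast
  have lower: "- b\<^sup>2 / 2 \<le> t + (norm x)\<^sup>2 / 2" if "(x, t) \<in> ?K" for x t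
  proof -
    have "0 \<le> (norm x - b)\<^sup>2" by simp
    then show ?thesis using that b[of x] by (auto simp: power2_diff field_simps abs_le_iff)
  qed
  obtain w t0 where w: "(w, t0) \<in> ?K" "\<And>x t. (x, t) \<in> ?K \<Longrightarrow> t0 \<le> t + w \<bullet> (x - w)"
    using quadratic_minimizer[OF conv compl _ lower] by blast
  have le: "f y \<le> w \<bullet> y" for y
    using w(1) w(2)[OF rangeI, of "w + y"] by (auto simp: f.add)
  have "f y = w \<bullet> y" for y
    using le[of y] le[of "- y"] by (simp add: f.neg)
  then show ?thesis by (rule that)
qed

text \<open>
  The functional \<open>x \<mapsto> L x \<bullet> y\<close> lives on the complete space \<open>'h\<close>, so it has a representing vector. This
  is the existence statement that makes the choice operator \<open>adjoint\<close> meaningful.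
\<close>

lemma adjoint_works_hilbert:
  fixes L :: "'h::{real_inner, complete_space} \<Rightarrow> 'g::real_inner"
  assumes L: "bounded_linear L"
  shows "x \<bullet> adjoint L y = L x \<bullet> y"
proof -
  have "\<exists>w. \<forall>x. L x \<bullet> y = x \<bullet> w" for y
  proof -
    have "bounded_linear (\<lambda>x. L x \<bullet> y)"
      by (rule bounded_linear_compose[OF bounded_linear_inner_left L])
    then obtain w where "\<And>x. L x \<bullet> y = w \<bullet> x"
      using riesz_representation by blast
    then show ?thesis by (metis inner_commute)
  qed
  then obtain L' where "\<forall>x y. L x \<bullet> y = x \<bullet> L' y" by metis
  then show ?thesis by (metis adjoint_unique)
qed

lemma adjoint_diff_hilbert:
  fixes L :: "'h::{real_inner, complete_space} \<Rightarrow> 'g::real_inner"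
  assumes L: "bounded_linear L"
  shows "adjoint L (a - b) = adjoint L a - adjoint L b"
proof -
  have "x \<bullet> adjoint L (a - b) = x \<bullet> (adjoint L a - adjoint L b)" for x
    by (simp add: adjoint_works_hilbert[OF L] inner_diff_right)
  then show ?thesis by (metis vector_eq_ldot)
qed

lemma norm_adjoint_le:
  fixes L :: "'h::{real_inner, complete_space} \<Rightarrow> 'g::real_inner"
  assumes L: "bounded_linear L"
  shows "norm (adjoint L y) \<le> onorm L * norm y"
proof (cases "adjoint L y = 0")
  case True
  then show ?thesis by (simp add: onorm_pos_le[OF L])
next
  case False
  let ?w = "adjoint L y"
  have "norm ?w * norm ?w = L ?w \<bullet> y"
    using adjoint_works_hilbert[OF L, of ?w y] by (simp add: power2_norm_eq_inner flip: power2_eq_square)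
  also have "\<dots> \<le> norm (L ?w) * norm y" by (rule norm_cauchy_schwarz)
  also have "\<dots> \<le> (onorm L * norm ?w) * norm y"
    by (intro mult_right_mono onorm[OF L]) simp
  finally have "norm ?w * norm ?w \<le> norm ?w * (onorm L * norm y)"
    by (simp add: mult_ac)
  with False show ?thesis by simp
qed

section \<open>Maximally monotone operators and their resolvents\<close>

lemma complete_Times:
  fixes S :: "'a::metric_space set" and T :: "'b::metric_space set"
  assumes "complete S" "complete T"
  shows "complete (S \<times> T)"
proof (rule completeI)
  fix f :: "nat \<Rightarrow> 'a \<times> 'b"
  assume f: "\<forall>n. f n \<in> S \<times> T" "Cauchy f"
  obtain a where a: "a \<in> S" "(\<lambda>n. fst (f n)) \<longlonglongrightarrow> a"
    using completeE[OF assms(1), of "\<lambda>n. fst (f n)"] f Cauchy_fst by (metis mem_Times_iff)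
  obtain b where b: "b \<in> T" "(\<lambda>n. snd (f n)) \<longlonglongrightarrow> b"
    using completeE[OF assms(2), of "\<lambda>n. snd (f n)"] f Cauchy_snd by (metis mem_Times_iff)
  have "f \<longlonglongrightarrow> (a, b)"
    using tendsto_Pair[OF a(2) b(2)] by simp
  with a b show "\<exists>l\<in>S \<times> T. f \<longlonglongrightarrow> l" by blast
qed


text \<open>
  Maximality in its usable form: any point that is monotonically related to the whole graph belongs
  to the graph, for otherwise it could be added.
\<close>

lemma maximally_monotone_on_iff:
  "maximally_monotone_on S M \<longleftrightarrow> operator_on S M \<and> monotone_op M \<and>
     (\<forall>x\<in>S. \<forall>u\<in>S. (\<forall>y v. v \<in> M y \<longrightarrow> 0 \<le> (x - y) \<bullet> (u - v)) \<longrightarrow> u \<in> M x)"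
  (is "?L \<longleftrightarrow> ?R")
proof
  assume max: ?L
  then have op: "operator_on S M" and mono: "monotone_op M"
    and nomax: "\<And>N. operator_on S N \<Longrightarrow> monotone_op N \<Longrightarrow> \<not> op_graph M \<subset> op_graph N"
    unfolding maximally_monotone_on_def by blast+
  have "u \<in> M x"
    if xu: "x \<in> S" "u \<in> S" and rel: "\<And>y v. v \<in> M y \<Longrightarrow> 0 \<le> (x - y) \<bullet> (u - v)" for x u
  proof (rule ccontr)
    assume notin: "u \<notin> M x"
    let ?N = "M(x := insert u (M x))"
    have "operator_on S ?N"
      using op xu by (auto simp: operator_on_def)
    moreover have "monotone_op ?N"
      unfolding monotone_op_def
    proof (intro allI impI)
      fix a b c d assume *: "c \<in> ?N a" "d \<in> ?N b"
      have flip: "(a - b) \<bullet> (c - d) = (b - a) \<bullet> (d - c)"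
        by (simp add: algebra_simps)
      consider "c \<in> M a" "d \<in> M b" | "a = x" "c = u" "d \<in> M b" | "b = x" "d = u" "c \<in> M a"
        | "a = b" "c = d"
        using * by (auto split: if_splits)
      then show "0 \<le> (a - b) \<bullet> (c - d)"
      proof cases
        case 1
        then show ?thesis using mono by (simp add: monotone_op_def)
      next
        case 2
        then show ?thesis using rel by simp
      next
        case 3
        then show ?thesis using rel flip by simp
      next
        case 4
        then show ?thesis by simp
      qed
    qed
    moreover have "op_graph M \<subset> op_graph ?N"
      using notin by (auto simp: op_graph_def)
    ultimately show False
      using nomax by blast
  qed
  then show ?R using op mono by blast
next
  assume R: ?R
  have False
    if N: "operator_on S N" "monotone_op N" "op_graph M \<subset> op_graph N" for N
  proof -
    obtain x u where xu: "u \<in> N x" "u \<notin> M x"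
      using N(3) by (auto simp: op_graph_def)
    have "0 \<le> (x - y) \<bullet> (u - v)" if "v \<in> M y" for y v
    proof -
      have "v \<in> N y" using that N(3) by (auto simp: op_graph_def)
      then show ?thesis using N(2) xu by (auto simp: monotone_op_def)
    qed
    moreover have "x \<in> S" "u \<in> S" using N(1) xu by (auto simp: operator_on_def)
    ultimately show False using R xu(2) by blast
  qed
  with R show ?L unfolding maximally_monotone_on_def by blast
qed


lemma maximally_monotone_on_op_inv:
  assumes "maximally_monotone_on S M"
  shows "maximally_monotone_on S (op_inv M)"
  unfolding maximally_monotone_on_iff
proof (intro conjI ballI impI)
  have M: "operator_on S M" "monotone_op M"
    "\<And>x u. x \<in> S \<Longrightarrow> u \<in> S \<Longrightarrow> (\<And>y v. v \<in> M y \<Longrightarrow> 0 \<le> (x - y) \<bullet> (u - v)) \<Longrightarrow> u \<in> M x"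
    using assms by (auto simp: maximally_monotone_on_iff)
  show "operator_on S (op_inv M)"
    using M(1) by (simp add: operator_on_def op_inv_def)
  show "monotone_op (op_inv M)"
    unfolding monotone_op_def op_inv_def mem_Collect_eq
    using M(2) by (metis monotone_op_def inner_commute)
  fix u x assume "u \<in> S" "x \<in> S"
    and rel: "\<forall>v y. y \<in> op_inv M v \<longrightarrow> 0 \<le> (u - v) \<bullet> (x - y)"
  have "u \<in> M x"
  proof (rule M(3))
    show "0 \<le> (x - y) \<bullet> (u - v)" if "v \<in> M y" for y v
      using rel that by (simp add: op_inv_def inner_commute)
  qed fact+
  then show "x \<in> op_inv M u" by (simp add: op_inv_def)
qed

text \<open>
  Solving \<open>w \<in> x + g M x\<close> is the same as finding \<open>x\<close> with \<open>- x \<in> g M x - w\<close>, so the resolvent equation is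
  reduced to an inclusion without parameters for the operator considered here.
\<close>

lemma maximally_monotone_on_affine:
  assumes S: "hilbert_subspace S" and M: "maximally_monotone_on S M"
    and w: "w \<in> S" and g: "(0::real) < g"
  shows "maximally_monotone_on S (\<lambda>x. (\<lambda>u. g *\<^sub>R u - w) ` M x)"
proof -
  have sub: "subspace S" using S by (simp add: hilbert_subspace_def)
  have M': "operator_on S M" "monotone_op M"
    "\<And>x u. x \<in> S \<Longrightarrow> u \<in> S \<Longrightarrow> (\<And>y v. v \<in> M y \<Longrightarrow> 0 \<le> (x - y) \<bullet> (u - v)) \<Longrightarrow> u \<in> M x"
    using M by (auto simp: maximally_monotone_on_iff)
  have "u \<in> (\<lambda>u. g *\<^sub>R u - w) ` M x"
    if xu: "x \<in> S" "u \<in> S"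
      and rel: "\<forall>y v. v \<in> (\<lambda>u. g *\<^sub>R u - w) ` M y \<longrightarrow> 0 \<le> (x - y) \<bullet> (u - v)" for x u
  proof -
    have "(1 / g) *\<^sub>R (u + w) \<in> M x"
    proof (rule M'(3))
      fix y v assume "v \<in> M y"
      have "(x - y) \<bullet> (u - (g *\<^sub>R v - w)) = g * ((x - y) \<bullet> ((1 / g) *\<^sub>R (u + w) - v))"
        using g by (simp add: algebra_simps)
      moreover have "0 \<le> (x - y) \<bullet> (u - (g *\<^sub>R v - w))"
        using rel \<open>v \<in> M y\<close> by blast
      ultimately have "0 \<le> g * ((x - y) \<bullet> ((1 / g) *\<^sub>R (u + w) - v))"
        by (simp only:)
      then show "0 \<le> (x - y) \<bullet> ((1 / g) *\<^sub>R (u + w) - v)"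
        using g by (simp only: zero_le_mult_iff) linarith
    qed (use xu w sub in \<open>auto intro: subspace_add subspace_scale\<close>)
    moreover have "u = g *\<^sub>R ((1 / g) *\<^sub>R (u + w)) - w" using g by simp
    ultimately show ?thesis by blast
  qed
  moreover have "operator_on S (\<lambda>x. (\<lambda>u. g *\<^sub>R u - w) ` M x)"
    using M'(1) w sub by (auto simp: operator_on_def intro: subspace_diff subspace_scale)
  moreover have "monotone_op (\<lambda>x. (\<lambda>u. g *\<^sub>R u - w) ` M x)"
    using M'(2) g by (auto simp: monotone_op_def simp flip: scaleR_diff_right)
  ultimately show ?thesis unfolding maximally_monotone_on_iff by blast
qed


text \<open>
  Minty's theorem at the origin. The set \<open>K\<close> below is the epigraph of the Fitzpatrick function
  \<open>F (x, u) = sup {x \<bullet> v + y \<bullet> u - y \<bullet> v | v \<in> M y}\<close>. Maximality gives \<open>F (x, u) \<ge> x \<bullet> u\<close>, so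
  \<open>F (x, u) + \<parallel>(x, u)\<parallel>\<^sup>2 / 2 \<ge> \<parallel>x + u\<parallel>\<^sup>2 / 2\<close> is bounded below, and it has a minimiser \<open>(x, u)\<close>. As \<open>F\<close> is at most
  \<open>y \<bullet> v\<close> on the graph, the optimality condition says that
  \<open>\<parallel>x + u\<parallel>\<^sup>2 \<le> (- u - y) \<bullet> (- x - v)\<close> for all \<open>v \<in> M y\<close>. Hence \<open>(- u, - x)\<close> lies in the graph by
  maximality, and inserting this very point yields \<open>x + u = 0\<close>.
\<close>

lemma maximally_monotone_obtains_minus:
  assumes S: "hilbert_subspace S" and M: "maximally_monotone_on S M"
  obtains x where "- x \<in> M x"
proof -
  have sub: "subspace S" and comp: "complete S" using S by (auto simp: hilbert_subspace_def)
  have M': "operator_on S M" "monotone_op M"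
    "\<And>x u. x \<in> S \<Longrightarrow> u \<in> S \<Longrightarrow> (\<And>y v. v \<in> M y \<Longrightarrow> 0 \<le> (x - y) \<bullet> (u - v)) \<Longrightarrow> u \<in> M x"
    using M by (auto simp: maximally_monotone_on_iff)
  define K where "K = ((S \<times> S) \<times> (UNIV::real set)) \<inter>
    (\<Inter>y. \<Inter>v\<in>M y. {k. fst (fst k) \<bullet> v + y \<bullet> snd (fst k) - y \<bullet> v \<le> snd k})"
  have K_iff: "((x, u), t) \<in> K \<longleftrightarrow>
      x \<in> S \<and> u \<in> S \<and> (\<forall>y v. v \<in> M y \<longrightarrow> x \<bullet> v + y \<bullet> u - y \<bullet> v \<le> t)" for x u t
    by (auto simp: K_def)
  have graph_K: "((y, v), y \<bullet> v) \<in> K" if "v \<in> M y" for y v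
  proof -
    have "0 \<le> (y - y') \<bullet> (v - v')" if "v' \<in> M y'" for y' v'
      using \<open>v \<in> M y\<close> that M'(2) by (auto simp: monotone_op_def)
    then show ?thesis
      using that M'(1) by (auto simp: K_iff operator_on_def algebra_simps)
  qed
  have fitz: "x \<bullet> u \<le> t" if k: "((x, u), t) \<in> K" for x u t
  proof (cases "u \<in> M x")
    case True
    then have "x \<bullet> u + x \<bullet> u - x \<bullet> u \<le> t" using k unfolding K_iff by blast
    then show ?thesis by simp
  next
    case False
    then obtain y v where yv: "v \<in> M y" "(x - y) \<bullet> (u - v) < 0"
      using M'(3)[of x u] k by (force simp: K_iff)
    then have "x \<bullet> v + y \<bullet> u - y \<bullet> v \<le> t" using k by (auto simp: K_iff)
    with yv(2) show ?thesis by (simp add: algebra_simps)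
  qed
  have "convex K"
  proof (rule convexI)
    fix a b :: "('a \<times> 'a) \<times> real" and s t :: real
    assume ab: "a \<in> K" "b \<in> K" and st: "0 \<le> s" "0 \<le> t" "s + t = 1"
    obtain x u c x' u' c' where [simp]: "a = ((x, u), c)" "b = ((x', u'), c')"
      by (metis surj_pair)
    have "(s *\<^sub>R x + t *\<^sub>R x') \<bullet> v + y \<bullet> (s *\<^sub>R u + t *\<^sub>R u') - y \<bullet> v \<le> s * c + t * c'"
      if "v \<in> M y" for y v
    proof -
      have "s * (x \<bullet> v + y \<bullet> u - y \<bullet> v) + t * (x' \<bullet> v + y \<bullet> u' - y \<bullet> v) \<le> s * c + t * c'"
        using ab st that by (intro add_mono mult_left_mono) (auto simp: K_iff)
      moreover have "y \<bullet> v = s * (y \<bullet> v) + t * (y \<bullet> v)"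
        using st(3) by (metis distrib_right mult_1)
      ultimately show ?thesis by (simp add: algebra_simps)
    qed
    then show "s *\<^sub>R a + t *\<^sub>R b \<in> K"
      using ab sub by (auto simp: K_iff intro: subspace_add subspace_scale)
  qed
  moreover have "complete K"
    unfolding K_def
    by (intro complete_Int_closed complete_Times comp complete_UNIV closed_INT ballI
        closed_Collect_le continuous_intros)
  moreover have "K \<noteq> {}"
  proof (cases "\<exists>y v. v \<in> M y")
    case True then show ?thesis using graph_K by blast
  next
    case False
    then show ?thesis using M'(3)[of 0 0] subspace_0[OF sub] by blast
  qed
  moreover have "0 \<le> t + (norm p)\<^sup>2 / 2" if "(p, t) \<in> K" for p t
  proof -
    obtain x u where [simp]: "p = (x, u)" by fastforce
    have "0 \<le> (x + u) \<bullet> (x + u)" by simp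
    then have "- (x \<bullet> u) \<le> (norm p)\<^sup>2 / 2"
      by (simp add: norm_Pair power2_norm_eq_inner algebra_simps inner_commute)
    then show ?thesis using fitz[of x u t] that by simp
  qed
  ultimately obtain p0 t0 where p0: "(p0, t0) \<in> K"
    "\<And>p t. (p, t) \<in> K \<Longrightarrow> t0 \<le> t + p0 \<bullet> (p - p0)"
    using quadratic_minimizer[of K 0] by metis
  obtain x u where p0_eq: "p0 = (x, u)" by fastforce
  have xu: "x \<in> S" "u \<in> S" "x \<bullet> u \<le> t0"
    using p0(1) fitz by (auto simp: K_iff p0_eq)
  have key: "(norm (x + u))\<^sup>2 \<le> (- u - y) \<bullet> (- x - v)" if "v \<in> M y" for y v
    using p0(2)[OF graph_K[OF that]] xu(3)
    by (simp add: p0_eq power2_norm_eq_inner algebra_simps inner_commute)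
  have in_M: "- x \<in> M (- u)"
  proof (rule M'(3))
    show "0 \<le> (- u - y) \<bullet> (- x - v)" if "v \<in> M y" for y v
      using key[OF that] by (meson order_trans zero_le_power2)
  qed (use xu sub in \<open>auto intro: subspace_neg\<close>)
  have "x + u = 0" using key[OF in_M] by simp
  then have "- u = x" by (simp add: add_eq_0_iff)
  with in_M show ?thesis using that by metis
qed


text \<open>
  Existence of the resolvent value is Minty's theorem and uniqueness is monotonicity; the value is
  recorded through the inclusion that characterises it.
\<close>

lemma op_val_resolvent:
  assumes S: "hilbert_subspace S" and M: "maximally_monotone_on S M"
    and w: "w \<in> S" and g: "0 < g" and p: "p = op_val (resolvent (op_scale g M)) w"
  shows "(1 / g) *\<^sub>R (w - p) \<in> M p"
proof -
  have resolvent_iff: "q \<in> resolvent (op_scale g M) w \<longleftrightarrow> (1 / g) *\<^sub>R (w - q) \<in> M q" for q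
  proof
    assume "q \<in> resolvent (op_scale g M) w"
    then obtain u where "u \<in> M q" "w = q + g *\<^sub>R u"
      by (auto simp: resolvent_def op_inv_def op_add_def single_op_def op_scale_def)
    then show "(1 / g) *\<^sub>R (w - q) \<in> M q" using g by simp
  next
    assume *: "(1 / g) *\<^sub>R (w - q) \<in> M q"
    have "w = q + g *\<^sub>R ((1 / g) *\<^sub>R (w - q))" using g by simp
    with * show "q \<in> resolvent (op_scale g M) w"
      unfolding resolvent_def op_inv_def op_add_def single_op_def op_scale_def by force
  qed
  obtain q where "- q \<in> (\<lambda>u. g *\<^sub>R u - w) ` M q"
    using maximally_monotone_obtains_minus[OF S maximally_monotone_on_affine[OF S M w g]] by blast
  then obtain u where u: "u \<in> M q" "- q = g *\<^sub>R u - w" by blast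
  then have "(1 / g) *\<^sub>R (w - q) = u"
    using g by (simp add: algebra_simps)
  with u have q: "q \<in> resolvent (op_scale g M) w" by (simp add: resolvent_iff)
  have "q' = q" if "q' \<in> resolvent (op_scale g M) w" for q'
  proof -
    have "0 \<le> (q' - q) \<bullet> ((1 / g) *\<^sub>R (w - q') - (1 / g) *\<^sub>R (w - q))"
      using M that q by (auto simp: maximally_monotone_on_def monotone_op_def resolvent_iff)
    also have "\<dots> = - (1 / g) * ((q' - q) \<bullet> (q' - q))"
      by (simp add: algebra_simps)
    finally have "(q' - q) \<bullet> (q' - q) \<le> 0" using g by (simp add: divide_le_0_iff)
    then show ?thesis by (simp flip: power2_norm_eq_inner)
  qed
  with q have "resolvent (op_scale g M) w = {q}" by blast
  then have "p = q" by (simp add: p op_val_def)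
  with q show ?thesis by (simp only: resolvent_iff)
qed


section \<open>One forward-backward-forward step\<close>

text \<open>
  Here \<open>x\<close>, \<open>p\<close>, \<open>x'\<close> are one component of the current iterate, of the intermediate point and of the next
  iterate, and \<open>c\<close> is that of the solution. Expanding squares gives an exact expression for
  \<open>\<parallel>x' - c\<parallel>\<^sup>2\<close>; the surplus \<open>2 g k \<parallel>p - c\<parallel>\<^sup>2\<close> from strong monotonicity is exchanged for a multiple of
  \<open>\<parallel>x' - c\<parallel>\<^sup>2\<close> by \<open>\<parallel>a + b\<parallel>\<^sup>2 \<le> \<parallel>a\<parallel>\<^sup>2 / (1 - g) + \<parallel>b\<parallel>\<^sup>2 / g\<close>, which is where the factor \<open>1 - g\<close> in the
  contraction rate comes from. The two last groups of terms have a sign only after summation over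
  the components.
\<close>

lemma tseng_step_component:
  fixes x p x' c :: "'a::real_inner"
  assumes g: "0 < g" "g < 1" and k: "0 \<le> k"
  shows "(1 + 2 * k * g * (1 - g)) * (norm (x' - c))\<^sup>2 \<le> (norm (x - c))\<^sup>2
    - 2 * ((p - c) \<bullet> (x - x') - g * k * (norm (p - c))\<^sup>2)
    + ((1 + 2 * k) * (norm (x' - p))\<^sup>2 - (norm (x - p))\<^sup>2)"
proof -
  have young: "g * (1 - g) * (norm (a + b))\<^sup>2 \<le> g * (norm a)\<^sup>2 + (1 - g) * (norm b)\<^sup>2" for a b :: 'a
  proof -
    have "0 \<le> (norm (g *\<^sub>R a - (1 - g) *\<^sub>R b))\<^sup>2" by simp
    also have "\<dots> = g * (norm a)\<^sup>2 + (1 - g) * (norm b)\<^sup>2 - g * (1 - g) * (norm (a + b))\<^sup>2"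
      by (simp add: power2_norm_eq_inner algebra_simps inner_commute)
    finally show ?thesis by simp
  qed
  have "(norm (x' - c))\<^sup>2 = (norm (x - c))\<^sup>2 - 2 * ((p - c) \<bullet> (x - x')) + (norm (x' - p))\<^sup>2 - (norm (x - p))\<^sup>2"
    by (simp add: power2_norm_eq_inner algebra_simps inner_commute)
  moreover have "2 * k * (g * (1 - g) * (norm (x' - c))\<^sup>2)
      \<le> 2 * k * (g * (norm (p - c))\<^sup>2 + (1 - g) * (norm (x' - p))\<^sup>2)"
    using young[of "p - c" "x' - p"] k by (intro mult_left_mono) auto
  moreover have "k * g * (norm (x' - p))\<^sup>2 \<ge> 0" using k g by simp
  ultimately show ?thesis by (simp add: algebra_simps)
qed

text \<open>
  The square of the operator norm of a block matrix with diagonal \<open>k\<close> and border \<open>l\<close> is at most the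
  square of the sum of the norms of its diagonal part and of its border. The cross terms are
  estimated by the Cauchy-Schwarz inequality and then by \<open>2 a0 b \<le> a0\<^sup>2 + b\<^sup>2\<close>. This bounds the
  Lipschitz constant of the forward operator.
\<close>

lemma skew_block_sum_le:
  fixes a l :: "'i \<Rightarrow> real"
  assumes nonneg: "0 \<le> k" "0 \<le> a0" "\<And>i. i \<in> I \<Longrightarrow> 0 \<le> a i" "\<And>i. i \<in> I \<Longrightarrow> 0 \<le> l i"
  shows "(k * a0 + (\<Sum>i\<in>I. l i * a i))\<^sup>2 + (\<Sum>i\<in>I. (k * a i + l i * a0)\<^sup>2)
    \<le> (sqrt (\<Sum>i\<in>I. (l i)\<^sup>2) + k)\<^sup>2 * (a0\<^sup>2 + (\<Sum>i\<in>I. (a i)\<^sup>2))"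
proof -
  define s b w where "s = L2_set l I" and "b = L2_set a I" and "w = (\<Sum>i\<in>I. l i * a i)"
  have s: "0 \<le> s" "(\<Sum>i\<in>I. (l i)\<^sup>2) = s\<^sup>2" "sqrt (\<Sum>i\<in>I. (l i)\<^sup>2) = s"
    and b: "0 \<le> b" "(\<Sum>i\<in>I. (a i)\<^sup>2) = b\<^sup>2"
    by (auto simp: s_def b_def L2_set_def sum_nonneg)
  have w: "0 \<le> w" "w \<le> s * b"
    using L2_set_mult_ineq[of l a I] nonneg
    by (auto simp: s_def b_def w_def intro!: sum_nonneg)
  have "(\<Sum>i\<in>I. (k * a i + l i * a0)\<^sup>2) = k\<^sup>2 * b\<^sup>2 + 2 * k * a0 * w + s\<^sup>2 * a0\<^sup>2"
    unfolding b(2)[symmetric] s(2)[symmetric] w_def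
    by (simp add: power2_sum power_mult_distrib sum.distrib sum_distrib_left sum_distrib_right algebra_simps)
  moreover have "w\<^sup>2 \<le> s\<^sup>2 * b\<^sup>2"
    using power_mono[OF w(2,1), of 2] by (simp add: power_mult_distrib)
  moreover have "k * a0 * w \<le> k * a0 * (s * b)"
    using nonneg w by (intro mult_left_mono) auto
  moreover have "0 \<le> k * s * (a0 - b)\<^sup>2" using nonneg s by simp
  ultimately show ?thesis
    unfolding s(3) b(2) w_def[symmetric]
    by (simp add: power2_eq_square algebra_simps)
qed

text \<open>
  The hypotheses \<open>primal\<close> and \<open>dual\<close> are strong monotonicity applied to the intermediate point \<open>(p, q)\<close>
  and the solution \<open>(xb, vb)\<close>; the hypotheses \<open>corr_x\<close> and \<open>corr_v\<close> are the componentwise Lipschitz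
  bounds on the correction. In the sum of the former the \<open>L\<close> terms cancel, and the latter
  combine with the step size bound so that the correction is dominated by the step to \<open>(p, q)\<close>.
\<close>

lemma primal_dual_step:
  fixes x x' p xb :: "'h::{real_inner, complete_space}"
    and v v' q vb :: "'i \<Rightarrow> 'g::real_inner"
  assumes L: "\<And>i. i \<in> I \<Longrightarrow> bounded_linear (L i)"
    and g: "0 < g" "g < 1" and k: "0 \<le> k" and c: "0 \<le> c"
    and step_size: "g \<le> 1 / (sqrt (1 + 2 * k) * (sqrt (\<Sum>i\<in>I. (onorm (L i))\<^sup>2) + c))"
    and primal: "k * (norm (p - xb))\<^sup>2
      \<le> (p - xb) \<bullet> ((1 / g) *\<^sub>R (x - x') - (\<Sum>i\<in>I. adjoint (L i) (q i - vb i)))"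
    and dual: "\<And>i. i \<in> I \<Longrightarrow> k * (norm (q i - vb i))\<^sup>2
      \<le> (q i - vb i) \<bullet> ((1 / g) *\<^sub>R (v i - v' i) + L i (p - xb))"
    and corr_x: "norm (x' - p) \<le> g * (c * norm (x - p) + (\<Sum>i\<in>I. onorm (L i) * norm (v i - q i)))"
    and corr_v: "\<And>i. i \<in> I \<Longrightarrow>
      norm (v' i - q i) \<le> g * (c * norm (v i - q i) + onorm (L i) * norm (x - p))"
  shows "(1 + 2 * k * g * (1 - g)) * ((norm (x' - xb))\<^sup>2 + (\<Sum>i\<in>I. (norm (v' i - vb i))\<^sup>2))
    \<le> (norm (x - xb))\<^sup>2 + (\<Sum>i\<in>I. (norm (v i - vb i))\<^sup>2)"
proof -
  define N where "N = (norm (x - p))\<^sup>2 + (\<Sum>i\<in>I. (norm (v i - q i))\<^sup>2)"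
  define N' where "N' = (norm (x' - p))\<^sup>2 + (\<Sum>i\<in>I. (norm (v' i - q i))\<^sup>2)"
  define E where "E = ((p - xb) \<bullet> (x - x') - g * k * (norm (p - xb))\<^sup>2)
    + (\<Sum>i\<in>I. (q i - vb i) \<bullet> (v i - v' i) - g * k * (norm (q i - vb i))\<^sup>2)"
  define \<beta> where "\<beta> = sqrt (\<Sum>i\<in>I. (onorm (L i))\<^sup>2) + c"
  have N_nonneg: "0 \<le> N" by (simp add: N_def sum_nonneg)
  have \<beta>_nonneg: "0 \<le> \<beta>" using c by (simp add: \<beta>_def sum_nonneg)
  have contraction: "(1 + 2 * k) * N' \<le> N"
  proof -
    have "N' \<le> (g * (c * norm (x - p) + (\<Sum>i\<in>I. onorm (L i) * norm (v i - q i))))\<^sup>2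
      + (\<Sum>i\<in>I. (g * (c * norm (v i - q i) + onorm (L i) * norm (x - p)))\<^sup>2)"
      unfolding N'_def by (intro add_mono sum_mono power_mono corr_x corr_v norm_ge_zero)
    also have "\<dots> = g\<^sup>2 * ((c * norm (x - p) + (\<Sum>i\<in>I. onorm (L i) * norm (v i - q i)))\<^sup>2
      + (\<Sum>i\<in>I. (c * norm (v i - q i) + onorm (L i) * norm (x - p))\<^sup>2))"
      by (simp only: power_mult_distrib sum_distrib_left[symmetric] distrib_left[symmetric])
    also have "\<dots> \<le> g\<^sup>2 * (\<beta>\<^sup>2 * N)"
      unfolding \<beta>_def N_def using c onorm_pos_le[OF L]
      by (intro mult_left_mono skew_block_sum_le) auto
    finally have "(1 + 2 * k) * N' \<le> (1 + 2 * k) * (g\<^sup>2 * (\<beta>\<^sup>2 * N))"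
      using k by (intro mult_left_mono) auto
    also have "\<dots> = (sqrt (1 + 2 * k) * \<beta> * g)\<^sup>2 * N"
      using k by (simp add: power_mult_distrib mult_ac)
    also have "\<dots> \<le> 1\<^sup>2 * N"
    proof (intro mult_right_mono power_mono)
      show "sqrt (1 + 2 * k) * \<beta> * g \<le> 1"
      \<comment> \<open>The step size bound reads \<open>g \<le> 1 / 0 = 0\<close> when \<open>\<beta> = 0\<close>, so this case is split off.\<close>
      proof (cases "\<beta> = 0")
        case False
        then have "0 < sqrt (1 + 2 * k) * \<beta>" using \<beta>_nonneg k by simp
        moreover have "g \<le> 1 / (sqrt (1 + 2 * k) * \<beta>)"
          using step_size by (simp only: \<beta>_def)
        ultimately have "g * (sqrt (1 + 2 * k) * \<beta>) \<le> 1"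
          by (simp only: pos_le_divide_eq)
        then show ?thesis by (simp only: mult_ac)
      qed simp
    qed (use N_nonneg \<beta>_nonneg g k in auto)
    finally show ?thesis by simp
  qed
  have energy: "0 \<le> E"
  proof -
    have scaled: "g * k * (norm (p - xb))\<^sup>2 \<le> (p - xb) \<bullet> (x - x')
        - g * (\<Sum>i\<in>I. L i (p - xb) \<bullet> (q i - vb i))"
    proof -
      have "g * (k * (norm (p - xb))\<^sup>2) \<le>
        g * ((p - xb) \<bullet> ((1 / g) *\<^sub>R (x - x') - (\<Sum>i\<in>I. adjoint (L i) (q i - vb i))))"
        using primal g by (intro mult_left_mono) auto
      also have "\<dots> = (p - xb) \<bullet> (x - x') - g * (\<Sum>i\<in>I. L i (p - xb) \<bullet> (q i - vb i))"
        unfolding inner_diff_right[of "p - xb" "(1 / g) *\<^sub>R (x - x')"] inner_sum_right inner_scaleR_right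
        using g adjoint_works_hilbert[OF L] by (simp add: right_diff_distrib)
      finally show ?thesis by (simp only: mult.assoc)
    qed
    have "g * k * (norm (q i - vb i))\<^sup>2 \<le> (q i - vb i) \<bullet> (v i - v' i)
        + g * (L i (p - xb) \<bullet> (q i - vb i))" if "i \<in> I" for i
    proof -
      have "g * (k * (norm (q i - vb i))\<^sup>2) \<le>
        g * ((q i - vb i) \<bullet> ((1 / g) *\<^sub>R (v i - v' i) + L i (p - xb)))"
        using dual[OF that] g by (intro mult_left_mono) auto
      also have "\<dots> = (q i - vb i) \<bullet> (v i - v' i) + g * (L i (p - xb) \<bullet> (q i - vb i))"
        unfolding inner_add_right[of "q i - vb i" "(1 / g) *\<^sub>R (v i - v' i)"] inner_scaleR_right
        using g by (simp add: distrib_left inner_commute)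
      finally show ?thesis by (simp only: mult.assoc)
    qed
    then have "0 \<le> (\<Sum>i\<in>I. (q i - vb i) \<bullet> (v i - v' i) - g * k * (norm (q i - vb i))\<^sup>2
        + g * (L i (p - xb) \<bullet> (q i - vb i)))"
      by (intro sum_nonneg) (simp add: algebra_simps)
    then show ?thesis
      using scaled unfolding E_def by (simp add: sum.distrib sum_distrib_left)
  qed
  have "(1 + 2 * k * g * (1 - g)) * ((norm (x' - xb))\<^sup>2 + (\<Sum>i\<in>I. (norm (v' i - vb i))\<^sup>2))
    \<le> ((norm (x - xb))\<^sup>2
        - 2 * ((p - xb) \<bullet> (x - x') - g * k * (norm (p - xb))\<^sup>2)
        + ((1 + 2 * k) * (norm (x' - p))\<^sup>2 - (norm (x - p))\<^sup>2))
      + (\<Sum>i\<in>I. (norm (v i - vb i))\<^sup>2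
        - 2 * ((q i - vb i) \<bullet> (v i - v' i) - g * k * (norm (q i - vb i))\<^sup>2)
        + ((1 + 2 * k) * (norm (v' i - q i))\<^sup>2 - (norm (v i - q i))\<^sup>2))"
    unfolding distrib_left[of _ "(norm (x' - xb))\<^sup>2"] sum_distrib_left
    by (intro add_mono sum_mono tseng_step_component g k)
  also have "\<dots> = ((norm (x - xb))\<^sup>2 + (\<Sum>i\<in>I. (norm (v i - vb i))\<^sup>2)) - 2 * E
      + ((1 + 2 * k) * N' - N)"
    unfolding E_def N_def N'_def sum.distrib sum_subtractf sum_distrib_left[symmetric]
    by (simp only: distrib_left right_diff_distrib)
  also have "\<dots> \<le> (norm (x - xb))\<^sup>2 + (\<Sum>i\<in>I. (norm (v i - vb i))\<^sup>2)"
    using energy contraction by simp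
  finally show ?thesis .
qed

section \<open>Linear convergence of the primal-dual iteration\<close>

theorem theorem3p4:
  fixes m :: nat
    and G :: "nat \<Rightarrow> 'g::real_inner set"
    and A :: "'h::{real_inner, complete_space} \<Rightarrow> 'h set"
    and C :: "'h \<Rightarrow> 'h"
    and z :: 'h
    and r :: "nat \<Rightarrow> 'g"
    and B D :: "nat \<Rightarrow> 'g \<Rightarrow> 'g set"
    and L :: "nat \<Rightarrow> 'h \<Rightarrow> 'g"
    and \<mu> \<rho> \<rho>min \<gamma> :: real
    and \<nu> \<tau> :: "nat \<Rightarrow> real"
    and xbar :: 'h and vbar :: "nat \<Rightarrow> 'g"
    and x p1 :: "nat \<Rightarrow> 'h"
    and v p2 :: "nat \<Rightarrow> nat \<Rightarrow> 'g"
  assumes G: "\<And>i. i \<in> {1..m} \<Longrightarrow> hilbert_subspace (G i)"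
    and A: "maximally_monotone_on UNIV A"
    and \<mu>: "\<mu> > 0"
    and C: "monotone_op (single_op C)" "\<mu>-lipschitz_on UNIV C"
    and r: "\<And>i. i \<in> {1..m} \<Longrightarrow> r i \<in> G i"
    and B: "\<And>i. i \<in> {1..m} \<Longrightarrow> maximally_monotone_on (G i) (B i)"
    and D: "\<And>i. i \<in> {1..m} \<Longrightarrow> operator_on (G i) (D i)"
           "\<And>i. i \<in> {1..m} \<Longrightarrow> monotone_op (D i)"
    and \<nu>: "\<And>i. i \<in> {1..m} \<Longrightarrow> \<nu> i > 0"
    and D_inv: "\<And>i. i \<in> {1..m} \<Longrightarrow> lipschitzian_op_on (\<nu> i) (G i) (op_inv (D i))"
    and L: "\<And>i. i \<in> {1..m} \<Longrightarrow> bounded_linear (L i)"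
           "\<And>i. i \<in> {1..m} \<Longrightarrow> range (L i) \<subseteq> G i"
           "\<And>i. i \<in> {1..m} \<Longrightarrow> L i \<noteq> (\<lambda>_. 0)"
    and \<rho>: "\<rho> > 0" "strongly_monotone_op \<rho> (op_add A (single_op C))"
    and \<tau>: "\<And>i. i \<in> {1..m} \<Longrightarrow> \<tau> i > 0"
           "\<And>i. i \<in> {1..m} \<Longrightarrow>
              strongly_monotone_op (\<tau> i) (op_add (op_inv (B i)) (op_inv (D i)))"
    and vbar_in: "\<And>i. i \<in> {1..m} \<Longrightarrow> vbar i \<in> G i"
    and primal: "z - (\<Sum>i=1..m. adjoint (L i) (vbar i)) \<in> op_add A (single_op C) xbar"
    and dual: "\<And>i. i \<in> {1..m} \<Longrightarrow> vbar i \<in> parallel_sum (B i) (D i) (L i xbar - r i)"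
    and \<rho>min: "\<rho>min = Min (insert \<rho> (\<tau> ` {1..m}))"
    and v0: "\<And>i. i \<in> {1..m} \<Longrightarrow> v i 0 \<in> G i"
    and \<gamma>: "0 < \<gamma>" "\<gamma> < 1"
           "\<gamma> \<le> 1 / (sqrt (1 + 2 * \<rho>min) *
                    (sqrt (\<Sum>i=1..m. (onorm (L i))\<^sup>2) + Max (insert \<mu> (\<nu> ` {1..m}))))"
    and p1: "\<And>n. p1 n = op_val (resolvent (op_scale \<gamma> A))
               (x n - \<gamma> *\<^sub>R (C (x n) + (\<Sum>i=1..m. adjoint (L i) (v i n)) - z))"
    and p2: "\<And>i n. i \<in> {1..m} \<Longrightarrow>
               p2 i n = op_val (resolvent (op_scale \<gamma> (op_inv (B i))))
                 (v i n + \<gamma> *\<^sub>R (L i (x n) - op_val (op_inv (D i)) (v i n) - r i))"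
    and v_Suc: "\<And>i n. i \<in> {1..m} \<Longrightarrow>
               v i (Suc n) = \<gamma> *\<^sub>R L i (p1 n - x n)
                 + \<gamma> *\<^sub>R (op_val (op_inv (D i)) (v i n) - op_val (op_inv (D i)) (p2 i n))
                 + p2 i n"
    and x_Suc: "\<And>n. x (Suc n) = \<gamma> *\<^sub>R (\<Sum>i=1..m. adjoint (L i) (v i n - p2 i n))
                 + \<gamma> *\<^sub>R (C (x n) - C (p1 n)) + p1 n"
  shows "\<forall>n. (norm (x n - xbar))\<^sup>2 + (\<Sum>i=1..m. (norm (v i n - vbar i))\<^sup>2)
           \<le> (1 / (1 + 2 * \<rho>min * \<gamma> * (1 - \<gamma>))) ^ n
              * ((norm (x 0 - xbar))\<^sup>2 + (\<Sum>i=1..m. (norm (v i 0 - vbar i))\<^sup>2))"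
proof
  have "0 < \<rho>min"
    unfolding \<rho>min using \<rho>(1) \<tau>(1) by (subst Min_gr_iff) auto
  moreover have "\<rho>min \<le> \<rho>" "\<And>i. i \<in> {1..m} \<Longrightarrow> \<rho>min \<le> \<tau> i"
    unfolding \<rho>min by (simp_all add: Min_le del: Min_insert)
  ultimately have k: "0 < \<rho>min" "\<rho>min \<le> \<rho>" "\<And>i. i \<in> {1..m} \<Longrightarrow> \<rho>min \<le> \<tau> i" .
  define c where "c = Max (insert \<mu> (\<nu> ` {1..m}))"
  have c: "\<mu> \<le> c" "\<And>i. i \<in> {1..m} \<Longrightarrow> \<nu> i \<le> c"
    unfolding c_def by (simp_all add: Max_ge del: Max_insert)
  define Dinv where "Dinv i = op_val (op_inv (D i))" for i
  have Dinv_iff: "w \<in> op_inv (D i) y \<longleftrightarrow> w = Dinv i y" if "i \<in> {1..m}" "y \<in> G i" for i y w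
    using D_inv[OF that(1)] that(2)
    by (auto simp: lipschitzian_op_on_def Dinv_def op_val_def is_singleton_def)
  have Dinv_in: "Dinv i y \<in> G i" if "i \<in> {1..m}" "y \<in> G i" for i y
    using Dinv_iff[OF that, of "Dinv i y"] D(1)[OF that(1)]
    by (auto simp: operator_on_def op_inv_def)
  have Dinv_lip: "norm (Dinv i y - Dinv i y') \<le> c * norm (y - y')"
    if "i \<in> {1..m}" "y \<in> G i" "y' \<in> G i" for i y y'
  proof -
    have "norm (Dinv i y - Dinv i y') \<le> \<nu> i * norm (y - y')"
      using D_inv[OF that(1)] that
      by (auto simp: lipschitzian_op_on_def Dinv_def lipschitz_on_def dist_norm)
    also have "\<dots> \<le> c * norm (y - y')"
      using c(2)[OF that(1)] by (intro mult_right_mono) auto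
    finally show ?thesis .
  qed
  have subspace_G: "subspace (G i)" if "i \<in> {1..m}" for i
    using G[OF that] by (simp add: hilbert_subspace_def)
  have L_in: "L i y \<in> G i" if "i \<in> {1..m}" for i y
    using L(2)[OF that] by blast
  have p2_res: "(1 / \<gamma>) *\<^sub>R (v i n + \<gamma> *\<^sub>R (L i (x n) - Dinv i (v i n) - r i) - p2 i n)
      \<in> op_inv (B i) (p2 i n)" if i: "i \<in> {1..m}" and "v i n \<in> G i" for i n
  proof (rule op_val_resolvent[OF G[OF i] maximally_monotone_on_op_inv[OF B[OF i]] _ \<gamma>(1)])
    show "v i n + \<gamma> *\<^sub>R (L i (x n) - Dinv i (v i n) - r i) \<in> G i"
      using subspace_G[OF i] that(2) L_in[OF i] r[OF i] Dinv_in[OF i that(2)]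
      by (intro subspace_add subspace_scale subspace_diff)
  qed (simp add: p2[OF i] Dinv_def)
  have p2_in: "p2 i n \<in> G i" if i: "i \<in> {1..m}" and "v i n \<in> G i" for i n
    using p2_res[OF that] B[OF i] by (auto simp: maximally_monotone_on_def operator_on_def op_inv_def)
  \<comment> \<open>The dual iterates must stay in \<open>G i\<close>, as \<open>D\<^sub>i\<inverse>\<close> is single-valued and Lipschitzian only there.\<close>
  have v_in: "v i n \<in> G i" if i: "i \<in> {1..m}" for i n
  proof (induction n)
    case (Suc n)
    then show ?case
      unfolding v_Suc[OF i] Dinv_def[symmetric]
      using subspace_G[OF i] L_in[OF i] Dinv_in[OF i] p2_in[OF i]
      by (intro subspace_add subspace_scale subspace_diff) auto
  qed (rule v0[OF i])
  define V where "V n = (norm (x n - xbar))\<^sup>2 + (\<Sum>i=1..m. (norm (v i n - vbar i))\<^sup>2)" for n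
  define q where "q = 1 + 2 * \<rho>min * \<gamma> * (1 - \<gamma>)"
  have q: "1 \<le> q" using k \<gamma> by (simp add: q_def)
  have step: "q * V (Suc n) \<le> V n" for n
    unfolding q_def V_def
  proof (rule primal_dual_step[where L = L and c = c and p = "p1 n" and q = "\<lambda>i. p2 i n"])
    show "\<gamma> \<le> 1 / (sqrt (1 + 2 * \<rho>min) * (sqrt (\<Sum>i=1..m. (onorm (L i))\<^sup>2) + c))"
      using \<gamma>(3) by (simp add: c_def)
    show "\<rho>min * (norm (p1 n - xbar))\<^sup>2 \<le> (p1 n - xbar) \<bullet>
        ((1 / \<gamma>) *\<^sub>R (x n - x (Suc n)) - (\<Sum>i=1..m. adjoint (L i) (p2 i n - vbar i)))"
    proof -
      define y where "y = x n - \<gamma> *\<^sub>R (C (x n) + (\<Sum>i=1..m. adjoint (L i) (v i n)) - z)"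
      have "(1 / \<gamma>) *\<^sub>R (y - p1 n) \<in> A (p1 n)"
        by (rule op_val_resolvent[OF _ A _ \<gamma>(1)])
           (simp_all add: hilbert_subspace_def complete_UNIV p1 y_def)
      then have "(1 / \<gamma>) *\<^sub>R (y - p1 n) + C (p1 n) \<in> op_add A (single_op C) (p1 n)"
        by (auto simp: op_add_def single_op_def)
      then have "\<rho> * (norm (p1 n - xbar))\<^sup>2 \<le> (p1 n - xbar) \<bullet> ((1 / \<gamma>) *\<^sub>R (y - p1 n) + C (p1 n)
          - (z - (\<Sum>i=1..m. adjoint (L i) (vbar i))))"
        using \<rho>(2) primal unfolding strongly_monotone_op_def by blast
      also have "(1 / \<gamma>) *\<^sub>R (y - p1 n) + C (p1 n) - (z - (\<Sum>i=1..m. adjoint (L i) (vbar i)))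
          = (1 / \<gamma>) *\<^sub>R (x n - x (Suc n)) - (\<Sum>i=1..m. adjoint (L i) (p2 i n - vbar i))"
      proof -
        have sums: "(\<Sum>i=1..m. adjoint (L i) (v i n - p2 i n))
            = (\<Sum>i=1..m. adjoint (L i) (v i n)) - (\<Sum>i=1..m. adjoint (L i) (p2 i n))"
          "(\<Sum>i=1..m. adjoint (L i) (p2 i n - vbar i))
            = (\<Sum>i=1..m. adjoint (L i) (p2 i n)) - (\<Sum>i=1..m. adjoint (L i) (vbar i))"
          by (simp_all add: adjoint_diff_hilbert[OF L(1)] sum_subtractf)
        show ?thesis
          unfolding y_def x_Suc sums using \<gamma>(1) by (simp add: algebra_simps)
      qed
      finally show ?thesis
        using k(2) by (meson mult_right_mono order_trans zero_le_power2)
    qed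
    show "norm (x (Suc n) - p1 n) \<le> \<gamma> * (c * norm (x n - p1 n)
        + (\<Sum>i=1..m. onorm (L i) * norm (v i n - p2 i n)))"
    proof -
      have "norm (x (Suc n) - p1 n)
          = norm (\<gamma> *\<^sub>R ((C (x n) - C (p1 n)) + (\<Sum>i=1..m. adjoint (L i) (v i n - p2 i n))))"
        by (simp add: x_Suc algebra_simps)
      also have "\<dots> = \<gamma> * norm ((C (x n) - C (p1 n)) + (\<Sum>i=1..m. adjoint (L i) (v i n - p2 i n)))"
        using \<gamma>(1) by simp
      also have "\<dots> \<le> \<gamma> * (norm (C (x n) - C (p1 n)) + (\<Sum>i=1..m. norm (adjoint (L i) (v i n - p2 i n))))"
        using \<gamma>(1) by (intro mult_left_mono norm_triangle_le add_left_mono norm_sum) auto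
      also have "\<dots> \<le> \<gamma> * (c * norm (x n - p1 n) + (\<Sum>i=1..m. onorm (L i) * norm (v i n - p2 i n)))"
      proof (intro mult_left_mono add_mono sum_mono norm_adjoint_le L(1))
        have "norm (C (x n) - C (p1 n)) \<le> \<mu> * norm (x n - p1 n)"
          using C(2) by (auto simp: lipschitz_on_def dist_norm)
        also have "\<dots> \<le> c * norm (x n - p1 n)"
          using c(1) by (intro mult_right_mono) auto
        finally show "norm (C (x n) - C (p1 n)) \<le> c * norm (x n - p1 n)" .
      qed (use \<gamma>(1) in auto)
      finally show ?thesis .
    qed
    fix i assume i: "i \<in> {1..m}"
    have G_in: "v i n \<in> G i" "p2 i n \<in> G i"
      using v_in[OF i] p2_in[OF i] by auto
    show "\<rho>min * (norm (p2 i n - vbar i))\<^sup>2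
        \<le> (p2 i n - vbar i) \<bullet> ((1 / \<gamma>) *\<^sub>R (v i n - v i (Suc n)) + L i (p1 n - xbar))"
    proof -
      interpret Li: bounded_linear "L i" by (rule L(1)[OF i])
      define y where "y = v i n + \<gamma> *\<^sub>R (L i (x n) - Dinv i (v i n) - r i)"
      have "(1 / \<gamma>) *\<^sub>R (y - p2 i n) + Dinv i (p2 i n)
          \<in> op_add (op_inv (B i)) (op_inv (D i)) (p2 i n)"
        using p2_res[OF i G_in(1)] Dinv_iff[OF i G_in(2)] by (auto simp: op_add_def y_def)
      moreover have "L i xbar - r i \<in> op_add (op_inv (B i)) (op_inv (D i)) (vbar i)"
        using dual[OF i] by (simp add: parallel_sum_def op_inv_def)
      ultimately have "\<tau> i * (norm (p2 i n - vbar i))\<^sup>2 \<le> (p2 i n - vbar i) \<bullet>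
          ((1 / \<gamma>) *\<^sub>R (y - p2 i n) + Dinv i (p2 i n) - (L i xbar - r i))"
        using \<tau>(2)[OF i] unfolding strongly_monotone_op_def by blast
      also have "(1 / \<gamma>) *\<^sub>R (y - p2 i n) + Dinv i (p2 i n) - (L i xbar - r i)
          = (1 / \<gamma>) *\<^sub>R (v i n - v i (Suc n)) + L i (p1 n - xbar)"
        using \<gamma>(1) by (simp add: y_def v_Suc[OF i] Dinv_def Li.diff algebra_simps)
      finally show ?thesis
        using k(3)[OF i] by (meson mult_right_mono order_trans zero_le_power2)
    qed
    show "norm (v i (Suc n) - p2 i n)
        \<le> \<gamma> * (c * norm (v i n - p2 i n) + onorm (L i) * norm (x n - p1 n))"
    proof -
      have "norm (v i (Suc n) - p2 i n)
          = norm (\<gamma> *\<^sub>R ((Dinv i (v i n) - Dinv i (p2 i n)) + L i (p1 n - x n)))"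
        by (simp add: v_Suc[OF i] Dinv_def algebra_simps)
      also have "\<dots> = \<gamma> * norm ((Dinv i (v i n) - Dinv i (p2 i n)) + L i (p1 n - x n))"
        using \<gamma>(1) by simp
      also have "\<dots> \<le> \<gamma> * (c * norm (v i n - p2 i n) + onorm (L i) * norm (p1 n - x n))"
        using \<gamma>(1) by (intro mult_left_mono norm_triangle_mono Dinv_lip[OF i G_in] onorm[OF L(1)[OF i]]) auto
      finally show ?thesis by (simp add: norm_minus_commute)
    qed
  qed (use L(1) \<gamma> k c \<mu> in auto)
  fix n
  have "V n \<le> (1 / q) ^ n * V 0"
  proof (induction n)
    case (Suc n)
    have "V (Suc n) \<le> (1 / q) * V n"
      using step[of n] q by (simp add: field_simps)
    also have "\<dots> \<le> (1 / q) * ((1 / q) ^ n * V 0)"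
      using Suc q by (intro mult_left_mono) auto
    finally show ?case by simp
  qed simp
  then show "(norm (x n - xbar))\<^sup>2 + (\<Sum>i=1..m. (norm (v i n - vbar i))\<^sup>2)
      \<le> (1 / (1 + 2 * \<rho>min * \<gamma> * (1 - \<gamma>))) ^ n
        * ((norm (x 0 - xbar))\<^sup>2 + (\<Sum>i=1..m. (norm (v i 0 - vbar i))\<^sup>2))"
    by (simp only: V_def q_def)
qed

end
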